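(* Let $X$ and $Y$ be connected graphs without loops and multiple edges, let $\phi:VX\to VY$ be a quasi-isometry with quasi-inverse $\psi$ and constants $a,b,c,d$, and let $\Phi:VX\cup\Omega_{\mathrm{P}}X\to VY\cup\Omega_{\mathrm{P}}Y$ be the unique map that extends $\phi$, is continuous for $\tau_{\mathrm{P}}X,\tau_{\mathrm{P}}Y$, and restricts to a homeomorphism $\Omega_{\mathrm{P}}X\to\Omega_{\mathrm{P}}Y$. Then for every $e\subseteq VX$ with $\operatorname{diam}\theta e<\infty$, the set $\Phi(e\cup\Omega_{\mathrm{P}}e)+(d+1)$ is open in $\tau_{\mathrm{P}}Y$.
   Context: $\phi:VX\to VY$ is a quasi-isometry with quasi-inverse $\psi:VY\to VX$ and constants $a,b,c,d$ if for all $x,x_1,x_2\in VX$, $y,y_1,y_2\in VY$: $\mathrm{d}_Y(\phi(x_1),\phi(x_2))\le a\,\mathrm{d}_X(x_1,x_2)$, $\mathrm{d}_X(\psi(y_1),\psi(y_2))\le b\,\mathrm{d}_Y(y_1,y_2)$, $\mathrm{d}_X(\psi\phi(x),x)\le c$, $\mathrm{d}_Y(\phi\psi(y),y)\le d$ (graph metrics). For $e\subseteq VX$, $e^{*}=VX\setminus e$, $\theta e$ is the set of vertices of $e^{*}$ adjacent to a vertex of $e$. A ray is a sequence of pairwise distinct vertices with consecutive ones adjacent; it lies in $e$ if all but finitely many of its vertices are in $e$; $e$ separates two rays if one lies in $e$ and the other in $e^{*}$. A metric cut is a set $e$ with $\operatorname{diam}\theta e<\infty$; a metric ray is a ray all of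 whose infinite subsequences have infinite diameter; metric rays are metrically equivalent if no metric cut separates them; the classes are proper metric ends; such an end lies in $e$ if all its rays lie in $e$; $\Omega_{\mathrm{P}}e$ is the set of these, $\Omega_{\mathrm{P}}X=\Omega_{\mathrm{P}}VX$. $\tau_{\mathrm{P}}Y$ is generated by $\{f\cup\Omega_{\mathrm{P}}f\mid f\subseteq VY,\ \operatorname{diam}\theta f<\infty\}$. For $A=B\cup E$ with $B\subseteq VY$, $E\subseteq\Omega_{\mathrm{P}}Y$ and natural $r$, $A+r:=\{y\in VY\mid \mathrm{d}_Y(y,B)\le r\}\cup E$. *)

theory Defs
  imports "HOL-Analysis.Analysis" "HOL-Library.Extended_Nat"
begin

record 'a ugraph =
  verts :: "'a set"
  edges :: "'a set set"

definition simple_graph :: "'a ugraph \<Rightarrow> bool" where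
  "simple_graph G \<longleftrightarrow> (\<forall>e\<in>edges G. e \<subseteq> verts G \<and> card e = 2)"

definition adjacent :: "'a ugraph \<Rightarrow> 'a \<Rightarrow> 'a \<Rightarrow> bool" where
  "adjacent G u v \<longleftrightarrow> {u, v} \<in> edges G"

definition connected_graph :: "'a ugraph \<Rightarrow> bool" where
  "connected_graph G \<longleftrightarrow> (\<forall>u\<in>verts G. \<forall>v\<in>verts G. (adjacent G)\<^sup>*\<^sup>* u v)"

text \<open>\<open>(adjacent G ^^ n) u v\<close> says that there is a walk of length \<open>n\<close> from \<open>u\<close> to \<open>v\<close>.
  The value is meaningful only if \<open>u\<close> and \<open>v\<close> are joined by some walk.\<close>

definition gdist :: "'a ugraph \<Rightarrow> 'a \<Rightarrow> 'a \<Rightarrow> nat" where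
  "gdist G u v = (LEAST n. (adjacent G ^^ n) u v)"

definition gsetdist :: "'a ugraph \<Rightarrow> 'a \<Rightarrow> 'a set \<Rightarrow> enat" where
  "gsetdist G u B = (INF v\<in>B. enat (gdist G u v))"

definition gdiam :: "'a ugraph \<Rightarrow> 'a set \<Rightarrow> enat" where
  "gdiam G A = (SUP u\<in>A. SUP v\<in>A. enat (gdist G u v))"

definition vboundary :: "'a ugraph \<Rightarrow> 'a set \<Rightarrow> 'a set" where
  "vboundary G e = {v \<in> verts G - e. \<exists>u\<in>e. adjacent G u v}"

definition metric_cut :: "'a ugraph \<Rightarrow> 'a set \<Rightarrow> bool" where
  "metric_cut G e \<longleftrightarrow> e \<subseteq> verts G \<and> gdiam G (vboundary G e) < \<infinity>"

definition ray :: "'a ugraph \<Rightarrow> (nat \<Rightarrow> 'a) \<Rightarrow> bool" where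
  "ray G x \<longleftrightarrow> range x \<subseteq> verts G \<and> inj x \<and> (\<forall>n. adjacent G (x n) (x (Suc n)))"

definition ray_lies_in :: "(nat \<Rightarrow> 'a) \<Rightarrow> 'a set \<Rightarrow> bool" where
  "ray_lies_in x e \<longleftrightarrow> finite {n. x n \<notin> e}"

definition separates :: "'a ugraph \<Rightarrow> 'a set \<Rightarrow> (nat \<Rightarrow> 'a) \<Rightarrow> (nat \<Rightarrow> 'a) \<Rightarrow> bool" where
  "separates G e x y \<longleftrightarrow>
     ray_lies_in x e \<and> ray_lies_in y (verts G - e) \<or>
     ray_lies_in y e \<and> ray_lies_in x (verts G - e)"

definition metric_ray :: "'a ugraph \<Rightarrow> (nat \<Rightarrow> 'a) \<Rightarrow> bool" where
  "metric_ray G x \<longleftrightarrow>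
     ray G x \<and> (\<forall>s::nat \<Rightarrow> nat. strict_mono s \<longrightarrow> gdiam G (range (x \<circ> s)) = \<infinity>)"

definition metric_equivalence :: "'a ugraph \<Rightarrow> ((nat \<Rightarrow> 'a) \<times> (nat \<Rightarrow> 'a)) set" where
  "metric_equivalence G =
     {(x, y). metric_ray G x \<and> metric_ray G y \<and> \<not> (\<exists>e. metric_cut G e \<and> separates G e x y)}"

definition proper_metric_ends :: "'a ugraph \<Rightarrow> (nat \<Rightarrow> 'a) set set" where
  "proper_metric_ends G = {x. metric_ray G x} // metric_equivalence G"

definition ends_in :: "'a ugraph \<Rightarrow> 'a set \<Rightarrow> (nat \<Rightarrow> 'a) set set" where
  "ends_in G e = {\<omega> \<in> proper_metric_ends G. \<forall>x\<in>\<omega>. ray_lies_in x e}"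

text \<open>Points of the disjoint union of the vertices and the proper metric ends are tagged
  by \<open>Inl\<close> and \<open>Inr\<close>, respectively.\<close>

type_synonym 'a vertex_or_end = "'a + (nat \<Rightarrow> 'a) set"

definition with_ends :: "'a ugraph \<Rightarrow> 'a set \<Rightarrow> 'a vertex_or_end set" where
  "with_ends G e = Inl ` e \<union> Inr ` ends_in G e"

definition end_points :: "'a ugraph \<Rightarrow> 'a vertex_or_end set" where
  "end_points G = Inr ` ends_in G (verts G)"

definition end_topology :: "'a ugraph \<Rightarrow> 'a vertex_or_end topology" where
  "end_topology G = topology_generated_by {with_ends G f |f. metric_cut G f}"

definition thicken :: "'a ugraph \<Rightarrow> 'a vertex_or_end set \<Rightarrow> nat \<Rightarrow> 'a vertex_or_end set" where
  "thicken G A r =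
     Inl ` {y \<in> verts G. gsetdist G y (Inl -` A) \<le> enat r} \<union> Inr ` (Inr -` A)"

definition quasi_isometry ::
  "'a ugraph \<Rightarrow> 'b ugraph \<Rightarrow> ('a \<Rightarrow> 'b) \<Rightarrow> ('b \<Rightarrow> 'a) \<Rightarrow> real \<Rightarrow> real \<Rightarrow> real \<Rightarrow> real \<Rightarrow> bool" where
  "quasi_isometry X Y \<phi> \<psi> a b c d \<longleftrightarrow>
     \<phi> \<in> verts X \<rightarrow> verts Y \<and> \<psi> \<in> verts Y \<rightarrow> verts X \<and>
     (\<forall>x1\<in>verts X. \<forall>x2\<in>verts X. real (gdist Y (\<phi> x1) (\<phi> x2)) \<le> a * real (gdist X x1 x2)) \<and>
     (\<forall>y1\<in>verts Y. \<forall>y2\<in>verts Y. real (gdist X (\<psi> y1) (\<psi> y2)) \<le> b * real (gdist Y y1 y2)) \<and>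
     (\<forall>x\<in>verts X. real (gdist X (\<psi> (\<phi> x)) x) \<le> c) \<and>
     (\<forall>y\<in>verts Y. real (gdist Y (\<phi> (\<psi> y)) y) \<le> d)"

definition end_extension ::
  "'a ugraph \<Rightarrow> 'b ugraph \<Rightarrow> ('a \<Rightarrow> 'b) \<Rightarrow> ('a vertex_or_end \<Rightarrow> 'b vertex_or_end) \<Rightarrow> bool" where
  "end_extension X Y \<phi> \<Phi> \<longleftrightarrow>
     (\<forall>x\<in>verts X. \<Phi> (Inl x) = Inl (\<phi> x)) \<and>
     continuous_map (end_topology X) (end_topology Y) \<Phi> \<and>
     homeomorphic_map (subtopology (end_topology X) (end_points X))
       (subtopology (end_topology Y) (end_points Y)) \<Phi>"

end

theory Submission imports Defs begin

text \<open>Every vertex is an isolated point, so only the ends in \<open>\<Phi>(\<Omega> e)\<close> need a neighbourhood inside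
  the thickened set. Since \<open>\<Phi>\<close> is a homeomorphism on ends, \<open>\<Phi>(\<Omega> e)\<close> is the trace of an open set \<open>U\<close>
  on the ends of \<open>Y\<close>. The set \<open>f = \<psi>\<^sup>-\<^sup>1(e)\<close> is a metric cut contained in the \<open>d\<close>-neighbourhood of \<open>\<phi>(e)\<close>,
  and every end in \<open>\<Phi>(\<Omega> e)\<close> lies in \<open>f\<close>: otherwise continuity of \<open>\<Phi>\<close> gives a metric cut
  \<open>h \<subseteq> e\<close> containing an end with \<open>\<psi>(\<phi>(h))\<close> disjoint from \<open>e\<close>, and then \<open>h\<close> stays within
  distance \<open>c\<close> of the boundary of \<open>e\<close>, so it is bounded and contains no metric ray.
  Hence \<open>U \<inter> (f \<union> \<Omega> f)\<close> is the required neighbourhood.\<close>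

section \<open>Finite diameter and walk distance\<close>

lemma gdiam_finite_iff:
  "gdiam G A < \<infinity> \<longleftrightarrow> (\<exists>N. \<forall>u\<in>A. \<forall>v\<in>A. gdist G u v \<le> N)"
proof
  assume "gdiam G A < \<infinity>"
  then obtain N where N: "gdiam G A = enat N" by auto
  have "gdist G u v \<le> N" if "u \<in> A" "v \<in> A" for u v
  proof -
    have "enat (gdist G u v) \<le> (SUP v\<in>A. enat (gdist G u v))" using that by (intro SUP_upper)
    also have "\<dots> \<le> gdiam G A" unfolding gdiam_def using that by (intro SUP_upper)
    finally show ?thesis using N by simp
  qed
  then show "\<exists>N. \<forall>u\<in>A. \<forall>v\<in>A. gdist G u v \<le> N" by blast
next
  assume "\<exists>N. \<forall>u\<in>A. \<forall>v\<in>A. gdist G u v \<le> N"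
  then obtain N where "\<forall>u\<in>A. \<forall>v\<in>A. gdist G u v \<le> N" by blast
  then have "gdiam G A \<le> enat N" unfolding gdiam_def by (intro SUP_least) auto
  then show "gdiam G A < \<infinity>" using enat_ord_simps(4) order_le_less_trans by blast
qed

lemma gdist_le: "(adjacent G ^^ n) u v \<Longrightarrow> gdist G u v \<le> n"
  unfolding gdist_def by (rule Least_le)

lemma gdist_self [simp]: "gdist G u u = 0"
  using gdist_le[of 0 G u u] by simp

section \<open>Metric rays and ends on the two sides of a metric cut\<close>

lemma metric_cut_verts: "metric_cut G (verts G)"
  unfolding metric_cut_def gdiam_finite_iff by (simp add: vboundary_def)

text \<open>Enumerating infinitely many visits to \<open>A\<close> in increasing order would yield a
  subsequence of finite diameter.\<close>

lemma metric_ray_bounded_finite: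
  assumes "metric_ray G x" "gdiam G A < \<infinity>"
  shows "finite {n. x n \<in> A}"
proof (rule ccontr)
  assume inf: "infinite {n. x n \<in> A}"
  define s where "s = enumerate {n. x n \<in> A}"
  have "range (x \<circ> s) \<subseteq> A" using enumerate_in_set[OF inf] unfolding s_def by auto
  then have "gdiam G (range (x \<circ> s)) < \<infinity>"
    using assms(2) unfolding gdiam_finite_iff by (meson subsetD)
  moreover have "strict_mono s" unfolding s_def by (rule strict_mono_enumerate[OF inf])
  ultimately show False using assms(1) unfolding metric_ray_def by auto
qed

lemma not_ray_lies_in_both:
  assumes "ray_lies_in x e" "ray_lies_in x (V - e)"
  shows False
proof -
  have "finite ({n. x n \<notin> e} \<union> {n. x n \<notin> V - e})" using assms unfolding ray_lies_in_def by blast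
  moreover have "{n. x n \<notin> e} \<union> {n. x n \<notin> V - e} = UNIV" by auto
  ultimately show False by (metis infinite_UNIV_nat)
qed

lemma ray_lies_in_Int: "ray_lies_in x e \<Longrightarrow> ray_lies_in x f \<Longrightarrow> ray_lies_in x (e \<inter> f)"
  unfolding ray_lies_in_def
  by (rule finite_subset[of _ "{n. x n \<notin> e} \<union> {n. x n \<notin> f}"]) auto

text \<open>A ray that visits both sides infinitely often leaves \<open>e\<close> infinitely often.
  Each exit lands in \<open>vboundary G e\<close>, and the vertices of a ray are indexed by
  infinitely many such exits only if the bounded boundary is visited infinitely often, which a
  metric ray excludes.\<close>

lemma metric_ray_lies_in_cut_or_complement:
  assumes x: "metric_ray G x" and e: "metric_cut G e"
  shows "ray_lies_in x e \<or> ray_lies_in x (verts G - e)"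
proof (rule ccontr)
  assume "\<not> ?thesis"
  moreover have V: "x n \<in> verts G" and adj: "adjacent G (x n) (x (Suc n))" for n
    using x unfolding metric_ray_def ray_def by auto
  ultimately have out: "infinite {n. x n \<notin> e}" and in_e: "infinite {n. x n \<in> e}"
    unfolding ray_lies_in_def by auto
  have "\<exists>n\<ge>m. x n \<in> vboundary G e" for m
  proof -
    obtain n where n: "n \<ge> m" "x n \<in> e" using in_e unfolding infinite_nat_iff_unbounded_le by auto
    obtain k where k: "k \<ge> n" "x k \<notin> e" using out unfolding infinite_nat_iff_unbounded_le by auto
    from k n have "\<exists>j\<ge>n. x j \<in> e \<and> x (Suc j) \<notin> e"
    proof (induction k rule: dec_induct)
      case (step i)
      then show ?case by (cases "x i \<in> e") auto
    qed simp
    then obtain j where "j \<ge> n" "x j \<in> e" "x (Suc j) \<notin> e" by blast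
    then have "x (Suc j) \<in> vboundary G e" using V adj unfolding vboundary_def by auto
    then show ?thesis using \<open>j \<ge> n\<close> n(1) by (intro exI[of _ "Suc j"]) auto
  qed
  then have "infinite {n. x n \<in> vboundary G e}" unfolding infinite_nat_iff_unbounded_le by auto
  moreover have "finite {n. x n \<in> vboundary G e}"
    using metric_ray_bounded_finite[OF x] e unfolding metric_cut_def by blast
  ultimately show False by blast
qed

text \<open>Classes are non-empty because a ray cannot lie both in a set and in its complement, so
  no cut separates it from itself.\<close>

lemma proper_metric_end_obtain_ray:
  assumes "\<omega> \<in> proper_metric_ends G"
  obtains x where "x \<in> \<omega>" "metric_ray G x"
proof -
  obtain x where x: "metric_ray G x" "\<omega> = metric_equivalence G `` {x}"
    using assms unfolding proper_metric_ends_def by (auto elim: quotientE)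
  have "\<not> separates G e x x" for e
    unfolding separates_def using not_ray_lies_in_both by blast
  then have "x \<in> \<omega>" using x unfolding metric_equivalence_def by simp
  with x that show thesis by blast
qed

text \<open>The cut decides the side of one representative, and every other ray of the end must be
  on the same side, as otherwise \<open>e\<close> would separate the two.\<close>

lemma proper_metric_end_lies_in_cut_or_complement:
  assumes \<omega>: "\<omega> \<in> proper_metric_ends G" and e: "metric_cut G e"
  shows "\<omega> \<in> ends_in G e \<or> \<omega> \<in> ends_in G (verts G - e)"
proof -
  obtain x where x: "metric_ray G x" "\<omega> = metric_equivalence G `` {x}"
    using \<omega> unfolding proper_metric_ends_def by (auto elim: quotientE)
  have y: "metric_ray G y" "\<not> separates G e x y" if "y \<in> \<omega>" for y
    using that x e unfolding metric_equivalence_def by auto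
  from metric_ray_lies_in_cut_or_complement[OF x(1) e] show ?thesis
    using metric_ray_lies_in_cut_or_complement[OF y(1) e] y(2) \<omega>
    unfolding ends_in_def separates_def by blast
qed

lemma ends_in_mono: "e \<subseteq> f \<Longrightarrow> ends_in G e \<subseteq> ends_in G f"
proof -
  assume "e \<subseteq> f"
  then have "ray_lies_in x f" if "ray_lies_in x e" for x
    using that unfolding ray_lies_in_def by (elim rev_finite_subset) blast
  then show "ends_in G e \<subseteq> ends_in G f" unfolding ends_in_def by blast
qed

lemma ends_in_Int: "ends_in G (e \<inter> f) = ends_in G e \<inter> ends_in G f"
proof
  show "ends_in G (e \<inter> f) \<subseteq> ends_in G e \<inter> ends_in G f" by (simp add: ends_in_mono)
  show "ends_in G e \<inter> ends_in G f \<subseteq> ends_in G (e \<inter> f)"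
    unfolding ends_in_def using ray_lies_in_Int by blast
qed

text \<open>A metric ray visits a bounded set only finitely often, so it cannot have almost all of
  its vertices there.\<close>

lemma ends_in_bounded:
  assumes "gdiam G e < \<infinity>"
  shows "ends_in G e = {}"
proof (rule ccontr)
  assume "ends_in G e \<noteq> {}"
  then obtain \<omega> where \<omega>: "\<omega> \<in> proper_metric_ends G" "\<forall>x\<in>\<omega>. ray_lies_in x e"
    unfolding ends_in_def by auto
  obtain x where x: "x \<in> \<omega>" "metric_ray G x" using \<omega>(1) by (rule proper_metric_end_obtain_ray)
  have "finite ({n. x n \<in> e} \<union> {n. x n \<notin> e})"
    using metric_ray_bounded_finite[OF x(2) assms] \<omega>(2) x(1) unfolding ray_lies_in_def by blast
  moreover have "{n. x n \<in> e} \<union> {n. x n \<notin> e} = UNIV" by auto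
  ultimately show False by (metis infinite_UNIV_nat)
qed

section \<open>The topology on vertices and ends\<close>

lemma openin_with_ends: "metric_cut G f \<Longrightarrow> openin (end_topology G) (with_ends G f)"
  unfolding end_topology_def by (rule topology_generated_by_Basis) blast

text \<open>The carrier of a generated topology is the union of its generators, and the cut
  \<open>verts G\<close> supplies the largest of them.\<close>

lemma topspace_end_topology: "topspace (end_topology G) = with_ends G (verts G)"
proof
  have "with_ends G f \<subseteq> with_ends G (verts G)" if "metric_cut G f" for f
    using that ends_in_mono[of f "verts G" G] unfolding with_ends_def metric_cut_def by blast
  then show "topspace (end_topology G) \<subseteq> with_ends G (verts G)"
    unfolding end_topology_def topology_generated_by_topspace by blast
  show "with_ends G (verts G) \<subseteq> topspace (end_topology G)"
    by (simp add: openin_with_ends metric_cut_verts openin_subset)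
qed

text \<open>Ensures that the subspace on the ends has carrier \<open>end_points G\<close> itself, so
  that surjectivity of a homeomorphism can be read off on this set.\<close>

lemma end_points_subset_topspace: "end_points G \<subseteq> topspace (end_topology G)"
  unfolding topspace_end_topology end_points_def with_ends_def by blast

section \<open>Distances and boundaries in a connected graph\<close>

locale simple_connected_graph =
  fixes G :: "'a ugraph"
  assumes simple: "simple_graph G" and connected: "connected_graph G"
begin

lemma adjacent_verts: "adjacent G u v \<Longrightarrow> u \<in> verts G \<and> v \<in> verts G"
  using simple unfolding simple_graph_def adjacent_def by blast

lemma adjacent_sym: "adjacent G u v \<Longrightarrow> adjacent G v u"
  unfolding adjacent_def by (simp add: insert_commute)

lemma walk_gdist:
  assumes "u \<in> verts G" "v \<in> verts G"
  shows "(adjacent G ^^ gdist G u v) u v"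
proof -
  obtain n where "(adjacent G ^^ n) u v"
    using connected assms unfolding connected_graph_def by (meson rtranclp_imp_relpowp)
  then show ?thesis unfolding gdist_def by (rule LeastI)
qed

lemma walk_sym: "(adjacent G ^^ n) u v \<Longrightarrow> (adjacent G ^^ n) v u"
proof (induction n arbitrary: v)
  case (Suc n)
  then obtain w where "(adjacent G ^^ n) u w" "adjacent G w v" by auto
  then show ?case using Suc.IH adjacent_sym by (meson relpowp_Suc_I2)
qed simp

lemma gdist_sym:
  assumes "u \<in> verts G" "v \<in> verts G"
  shows "gdist G u v = gdist G v u"
  using gdist_le[OF walk_sym[OF walk_gdist[OF assms]]]
    gdist_le[OF walk_sym[OF walk_gdist[OF assms(2,1)]]] by (rule antisym[rotated])

lemma gdist_triangle:
  assumes "u \<in> verts G" "v \<in> verts G" "w \<in> verts G"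
  shows "gdist G u w \<le> gdist G u v + gdist G v w"
  using walk_gdist[OF assms(1,2)] walk_gdist[OF assms(2,3)]
  by (intro gdist_le) (unfold relpowp_add, rule relcomppI)

lemma walk_crosses_vboundary:
  assumes "(adjacent G ^^ n) u v" "u \<in> e" "v \<notin> e"
  shows "\<exists>w\<in>vboundary G e. gdist G u w \<le> n \<and> gdist G w v \<le> n"
proof -
  \<comment> \<open>The witness is the first vertex of the walk outside \<open>e\<close>. The
    induction speaks of walks because the part before \<open>w\<close> grows by one edge in each
    step while the part after it is kept.\<close>
  have "\<exists>w\<in>vboundary G e. \<exists>i\<le>n. \<exists>j\<le>n. (adjacent G ^^ i) u w \<and> (adjacent G ^^ j) w v"
    using assms
  proof (induction n arbitrary: u)
    case (Suc n)
    then obtain u' where u': "adjacent G u u'" "(adjacent G ^^ n) u' v"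
      by (meson relpowp_Suc_D2)
    show ?case
    proof (cases "u' \<in> e")
      case True
      then obtain w i j where "w \<in> vboundary G e" "i \<le> n" "j \<le> n"
        "(adjacent G ^^ i) u' w" "(adjacent G ^^ j) w v"
        using Suc u' by blast
      moreover have "(adjacent G ^^ Suc i) u w"
        using u'(1) \<open>(adjacent G ^^ i) u' w\<close> by (rule relpowp_Suc_I2)
      ultimately show ?thesis
        by (intro bexI[of _ w] exI[of _ "Suc i"] conjI exI[of _ j]) simp_all
    next
      case False
      then have "u' \<in> vboundary G e"
        using u' Suc.prems adjacent_verts unfolding vboundary_def by blast
      then show ?thesis using u'
        by (intro bexI[of _ u'] exI[of _ "Suc 0"] conjI exI[of _ n]) auto
    qed
  qed simp
  then show ?thesis by (auto dest!: gdist_le intro: order_trans)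
qed

lemma near_vboundary:
  assumes "u \<in> e" "v \<notin> e" "u \<in> verts G" "v \<in> verts G"
  obtains w where "w \<in> vboundary G e" "gdist G u w \<le> gdist G u v" "gdist G v w \<le> gdist G u v"
proof -
  obtain w where w: "w \<in> vboundary G e" "gdist G u w \<le> gdist G u v" "gdist G w v \<le> gdist G u v"
    using walk_crosses_vboundary[OF walk_gdist[OF assms(3,4)] assms(1,2)] by blast
  moreover have "gdist G w v = gdist G v w"
    using w(1) assms(4) by (intro gdist_sym) (auto simp: vboundary_def)
  ultimately show thesis using that by simp
qed

text \<open>Passing through two points of \<open>A\<close> costs at most \<open>r\<close> at either
  end. This is the main device for bounding diameters below: a nearby set already known to be
  bounded is exhibited.\<close>

lemma gdiam_neighbourhood:
  assumes "gdiam G A < \<infinity>" "A \<subseteq> verts G" "B \<subseteq> verts G"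
    and near: "\<And>x. x \<in> B \<Longrightarrow> \<exists>w\<in>A. gdist G x w \<le> r"
  shows "gdiam G B < \<infinity>"
proof -
  obtain N where N: "\<forall>u\<in>A. \<forall>v\<in>A. gdist G u v \<le> N" using assms(1) unfolding gdiam_finite_iff by blast
  have "gdist G x y \<le> r + (N + r)" if xy: "x \<in> B" "y \<in> B" for x y
  proof -
    obtain u where u: "u \<in> A" "gdist G x u \<le> r" using near xy by blast
    obtain v where v: "v \<in> A" "gdist G y v \<le> r" using near xy by blast
    have V: "x \<in> verts G" "y \<in> verts G" "u \<in> verts G" "v \<in> verts G" using u v xy assms(2,3) by auto
    have "gdist G x y \<le> gdist G x u + gdist G u y" using V by (intro gdist_triangle)
    moreover have "gdist G u y \<le> gdist G u v + gdist G v y" using V by (intro gdist_triangle)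
    moreover have "gdist G v y \<le> r" using v gdist_sym[OF V(4,2)] by simp
    moreover have "gdist G u v \<le> N" using N u v by blast
    ultimately show ?thesis using u by linarith
  qed
  then show ?thesis unfolding gdiam_finite_iff by blast
qed

lemma gdiam_Un:
  assumes "gdiam G A < \<infinity>" "gdiam G B < \<infinity>" "A \<subseteq> verts G" "B \<subseteq> verts G"
  shows "gdiam G (A \<union> B) < \<infinity>"
proof (cases "A = {} \<or> B = {}")
  case False
  then obtain p q where pq: "p \<in> A" "q \<in> B" by auto
  obtain N where N: "\<forall>u\<in>B. \<forall>v\<in>B. gdist G u v \<le> N" using assms(2) unfolding gdiam_finite_iff by blast
  \<comment> \<open>A point of \<open>B\<close> reaches \<open>p\<close> by way of \<open>q\<close>,
    which explains the radius around \<open>A\<close>.\<close>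
  show ?thesis
  proof (rule gdiam_neighbourhood[OF assms(1,3), where r = "N + gdist G q p"])
    show "A \<union> B \<subseteq> verts G" using assms by auto
    fix x assume "x \<in> A \<union> B"
    then show "\<exists>w\<in>A. gdist G x w \<le> N + gdist G q p"
    proof
      assume "x \<in> A" then show ?thesis by (intro bexI[of _ x]) auto
    next
      assume x: "x \<in> B"
      have "gdist G x p \<le> gdist G x q + gdist G q p" using x pq assms by (intro gdist_triangle) auto
      moreover have "gdist G x q \<le> N" using N x pq by blast
      ultimately show ?thesis using pq by (intro bexI[of _ p]) auto
    qed
  qed
qed (use assms in auto)

section \<open>Operations on metric cuts, and neighbourhoods of vertices and ends\<close>

lemma metric_cut_Int:
  assumes "metric_cut G e" "metric_cut G f"
  shows "metric_cut G (e \<inter> f)"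
proof -
  have "gdiam G (vboundary G e \<union> vboundary G f) < \<infinity>"
    using assms unfolding metric_cut_def by (intro gdiam_Un) (auto simp: vboundary_def)
  moreover have "vboundary G (e \<inter> f) \<subseteq> vboundary G e \<union> vboundary G f"
    unfolding vboundary_def by auto
  ultimately have "gdiam G (vboundary G (e \<inter> f)) < \<infinity>"
    unfolding gdiam_finite_iff by (meson subsetD)
  then show ?thesis using assms unfolding metric_cut_def by blast
qed

text \<open>Boundaries consist of outer vertices, so the complement has a different boundary, now
  inside \<open>e\<close>; each of its vertices is one edge away from the old boundary.\<close>

lemma metric_cut_complement:
  assumes "metric_cut G e"
  shows "metric_cut G (verts G - e)"
proof -
  have "gdiam G (vboundary G (verts G - e)) < \<infinity>"
  proof (rule gdiam_neighbourhood[where r = 1])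
    show "gdiam G (vboundary G e) < \<infinity>" using assms unfolding metric_cut_def by blast
    fix x assume "x \<in> vboundary G (verts G - e)"
    then obtain u where u: "x \<in> e" "u \<in> verts G - e" "adjacent G u x"
      unfolding vboundary_def by auto
    then have "u \<in> vboundary G e" using adjacent_sym unfolding vboundary_def by blast
    moreover have "gdist G x u \<le> 1" using u adjacent_sym by (intro gdist_le) auto
    ultimately show "\<exists>w\<in>vboundary G e. gdist G x w \<le> 1" by blast
  qed (auto simp: vboundary_def)
  then show ?thesis unfolding metric_cut_def by blast
qed

lemma metric_cut_singleton:
  assumes "v \<in> verts G"
  shows "metric_cut G {v}"
proof -
  have "gdiam G (vboundary G {v}) < \<infinity>"
  proof (rule gdiam_neighbourhood[where A = "{v}" and r = 1])
    show "gdiam G {v} < \<infinity>" unfolding gdiam_finite_iff by simp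
    fix x assume "x \<in> vboundary G {v}"
    then have "adjacent G x v" using adjacent_sym unfolding vboundary_def by auto
    then show "\<exists>w\<in>{v}. gdist G x w \<le> 1" using gdist_le[of 1 G x v] by auto
  qed (use assms in \<open>auto simp: vboundary_def\<close>)
  then show ?thesis using assms unfolding metric_cut_def by blast
qed

text \<open>A single vertex is a metric cut, and being bounded it contains no end, so the generating
  set it defines has no further point.\<close>

lemma openin_vertex:
  assumes "v \<in> verts G"
  shows "openin (end_topology G) {Inl v}"
proof -
  have "ends_in G {v} = {}" by (rule ends_in_bounded) (unfold gdiam_finite_iff, simp)
  then have "with_ends G {v} = {Inl v}" unfolding with_ends_def by simp
  then show ?thesis using openin_with_ends[OF metric_cut_singleton[OF assms]] by simp
qed

text \<open>Metric cuts are closed under intersection, and \<open>ends_in\<close> commutes with it.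
  The generators therefore already form a neighbourhood base at each end.\<close>

lemma end_neighbourhood_contains_cut:
  assumes "openin (end_topology G) U" "Inr \<omega> \<in> U"
  obtains h where "metric_cut G h" "\<omega> \<in> ends_in G h" "with_ends G h \<subseteq> U"
proof -
  have "generate_topology_on {with_ends G f |f. metric_cut G f} U"
    using assms(1) unfolding end_topology_def openin_topology_generated_by_iff .
  then have "Inr \<omega> \<in> U \<longrightarrow> (\<exists>h. metric_cut G h \<and> \<omega> \<in> ends_in G h \<and> with_ends G h \<subseteq> U)"
  proof induction
    case (Int U V)
    show ?case
    proof
      assume "Inr \<omega> \<in> U \<inter> V"
      then obtain h k where "metric_cut G h" "\<omega> \<in> ends_in G h" "with_ends G h \<subseteq> U"
        "metric_cut G k" "\<omega> \<in> ends_in G k" "with_ends G k \<subseteq> V" using Int by auto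
      moreover have "with_ends G (h \<inter> k) \<subseteq> with_ends G h \<inter> with_ends G k"
        unfolding with_ends_def ends_in_Int by auto
      ultimately show "\<exists>h. metric_cut G h \<and> \<omega> \<in> ends_in G h \<and> with_ends G h \<subseteq> U \<inter> V"
        by (intro exI[of _ "h \<inter> k"]) (auto simp: metric_cut_Int ends_in_Int)
    qed
  next
    case (Basis U)
    then show ?case unfolding with_ends_def by auto
  qed (simp, blast)
  with assms(2) that show thesis by blast
qed

end

section \<open>Cuts and ends under a quasi-isometry\<close>

lemma metric_cut_quasi_preimage:
  assumes "simple_connected_graph X" "simple_connected_graph Y"
    and qi: "quasi_isometry X Y \<phi> \<psi> a b c d" and e: "metric_cut X e"
  shows "metric_cut Y {y \<in> verts Y. \<psi> y \<in> e}"
proof -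
  interpret X: simple_connected_graph X by fact
  interpret Y: simple_connected_graph Y by fact
  let ?f = "{y \<in> verts Y. \<psi> y \<in> e}"
  let ?B = "vboundary Y ?f"
  have \<phi>V: "\<And>x. x \<in> verts X \<Longrightarrow> \<phi> x \<in> verts Y" and \<psi>V: "\<And>y. y \<in> verts Y \<Longrightarrow> \<psi> y \<in> verts X"
    using qi unfolding quasi_isometry_def by auto
  have BV: "?B \<subseteq> verts Y" by (auto simp: vboundary_def)
  \<comment> \<open>An edge leaving \<open>?f\<close> is sent by \<psi> to a pair of vertices, one
    in \<open>e\<close> and one outside, at distance at most \<open>b\<close>. A shortest walk
    between them meets the boundary of \<open>e\<close>. Absolute values keep the estimates
    monotone, since no sign is assumed for the constants.\<close>
  have "gdiam X (\<psi> ` ?B) < \<infinity>"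
  proof (rule X.gdiam_neighbourhood[where r = "nat \<lceil>\<bar>b\<bar>\<rceil>"])
    show "gdiam X (vboundary X e) < \<infinity>" using e unfolding metric_cut_def by blast
    show "vboundary X e \<subseteq> verts X" by (auto simp: vboundary_def)
    show "\<psi> ` ?B \<subseteq> verts X" using BV \<psi>V by blast
    fix x assume "x \<in> \<psi> ` ?B"
    then obtain y where y: "x = \<psi> y" "y \<in> ?B" by blast
    then obtain z where z: "z \<in> verts Y" "\<psi> z \<in> e" "adjacent Y z y" and y': "y \<in> verts Y" "\<psi> y \<notin> e"
      unfolding vboundary_def by auto
    have "gdist Y z y \<le> 1" using z by (intro gdist_le) auto
    have "real (gdist X (\<psi> z) (\<psi> y)) \<le> b * real (gdist Y z y)"
      using qi z y' unfolding quasi_isometry_def by blast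
    also have "\<dots> \<le> \<bar>b\<bar> * 1" using \<open>gdist Y z y \<le> 1\<close> by (intro mult_mono) auto
    finally have "gdist X (\<psi> z) (\<psi> y) \<le> nat \<lceil>\<bar>b\<bar>\<rceil>" by linarith
    moreover obtain w where "w \<in> vboundary X e" "gdist X (\<psi> y) w \<le> gdist X (\<psi> z) (\<psi> y)"
      using X.near_vboundary[OF z(2) y'(2)] \<psi>V z(1) y'(1) by blast
    ultimately show "\<exists>w\<in>vboundary X e. gdist X x w \<le> nat \<lceil>\<bar>b\<bar>\<rceil>"
      using y(1) by (meson order_trans)
  qed
  then obtain N where N: "\<forall>u\<in>\<psi> ` ?B. \<forall>v\<in>\<psi> ` ?B. gdist X u v \<le> N"
    unfolding gdiam_finite_iff by blast
  \<comment> \<open>The bound on \<psi> does not directly control distances in \<open>Y\<close>. It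
    is carried back by \<phi>, and \<phi>\<psi> moves each vertex of \<open>?B\<close> by at most
    \<open>d\<close>.\<close>
  have "gdiam Y (\<phi> ` \<psi> ` ?B) < \<infinity>"
    unfolding gdiam_finite_iff
  proof (intro exI ballI)
    fix p q assume "p \<in> \<phi> ` \<psi> ` ?B" "q \<in> \<phi> ` \<psi> ` ?B"
    then obtain u v where uv: "u \<in> \<psi> ` ?B" "v \<in> \<psi> ` ?B" "p = \<phi> u" "q = \<phi> v" by blast
    then have "u \<in> verts X" "v \<in> verts X" using BV \<psi>V by auto
    then have "real (gdist Y p q) \<le> a * real (gdist X u v)"
      using qi uv unfolding quasi_isometry_def by blast
    also have "\<dots> \<le> \<bar>a\<bar> * real N" using N uv by (intro mult_mono) auto
    finally show "gdist Y p q \<le> nat \<lceil>\<bar>a\<bar> * real N\<rceil>" by linarith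
  qed
  then have "gdiam Y ?B < \<infinity>"
  proof (rule Y.gdiam_neighbourhood[where r = "nat \<lceil>d\<rceil>"])
    show "\<phi> ` \<psi> ` ?B \<subseteq> verts Y" using BV \<psi>V \<phi>V by blast
    fix y assume y: "y \<in> ?B"
    then have "real (gdist Y (\<phi> (\<psi> y)) y) \<le> d"
      using qi BV unfolding quasi_isometry_def by blast
    moreover have "gdist Y (\<phi> (\<psi> y)) y = gdist Y y (\<phi> (\<psi> y))"
      using y BV \<psi>V \<phi>V by (intro Y.gdist_sym) auto
    ultimately have "gdist Y y (\<phi> (\<psi> y)) \<le> nat \<lceil>d\<rceil>" by linarith
    then show "\<exists>w\<in>\<phi> ` \<psi> ` ?B. gdist Y y w \<le> nat \<lceil>d\<rceil>" using y by blast
  qed (use BV in auto)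
  then show ?thesis unfolding metric_cut_def by blast
qed

text \<open>The homeomorphism has image exactly \<open>end_points Y\<close>, which rules out a
  vertex as the value at an end.\<close>

lemma end_extension_maps_end:
  assumes "end_extension X Y \<phi> \<Phi>" "\<omega> \<in> ends_in X (verts X)"
  obtains \<eta> where "\<Phi> (Inr \<omega>) = Inr \<eta>" "\<eta> \<in> ends_in Y (verts Y)"
proof -
  have "\<Phi> ` end_points X = end_points Y"
    using assms(1) homeomorphic_imp_surjective_map end_points_subset_topspace
    unfolding end_extension_def by (metis topspace_subtopology_subset)
  moreover have "Inr \<omega> \<in> end_points X" using assms(2) unfolding end_points_def by blast
  ultimately have "\<Phi> (Inr \<omega>) \<in> end_points Y" by blast
  then show thesis using that unfolding end_points_def by blast
qed

lemma end_extension_image_in_quasi_preimage: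
  assumes "simple_connected_graph X" "simple_connected_graph Y"
    and qi: "quasi_isometry X Y \<phi> \<psi> a b c d" and ext: "end_extension X Y \<phi> \<Phi>"
    and e: "metric_cut X e" and \<omega>: "\<omega> \<in> ends_in X e" and \<eta>: "\<Phi> (Inr \<omega>) = Inr \<eta>"
  shows "\<eta> \<in> ends_in Y {y \<in> verts Y. \<psi> y \<in> e}"
proof (rule ccontr)
  interpret X: simple_connected_graph X by fact
  interpret Y: simple_connected_graph Y by fact
  let ?f = "{y \<in> verts Y. \<psi> y \<in> e}"
  assume "\<eta> \<notin> ends_in Y ?f"
  have f: "metric_cut Y ?f" using assms by (intro metric_cut_quasi_preimage)
  have eV: "e \<subseteq> verts X" using e unfolding metric_cut_def by blast
  have \<omega>V: "\<omega> \<in> ends_in X (verts X)" using \<omega> ends_in_mono[OF eV] by blast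
  have "\<eta> \<in> ends_in Y (verts Y)" using end_extension_maps_end[OF ext \<omega>V] \<eta> by (metis sum.inject(2))
  \<comment> \<open>Not lying in \<open>?f\<close> says only that some ray of \<eta> fails to do so;
    as \<open>?f\<close> is a cut, the dichotomy puts all its rays into the complement.\<close>
  then have "\<eta> \<in> ends_in Y (verts Y - ?f)"
    using proper_metric_end_lies_in_cut_or_complement[OF _ f] \<open>\<eta> \<notin> ends_in Y ?f\<close>
    unfolding ends_in_def[of Y "verts Y"] by blast
  then have \<Phi>\<omega>: "\<Phi> (Inr \<omega>) \<in> with_ends Y (verts Y - ?f)" unfolding \<eta> with_ends_def by blast
  define U where "U = {p \<in> topspace (end_topology X). \<Phi> p \<in> with_ends Y (verts Y - ?f)}"
  have "openin (end_topology X) U"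
    unfolding U_def using ext openin_with_ends[OF Y.metric_cut_complement[OF f]]
    unfolding end_extension_def by (blast intro: openin_continuous_map_preimage)
  moreover have "Inr \<omega> \<in> U"
    using \<Phi>\<omega> \<omega>V unfolding U_def topspace_end_topology with_ends_def by blast
  ultimately obtain h where h: "metric_cut X h" "\<omega> \<in> ends_in X h" "with_ends X h \<subseteq> U"
    by (rule X.end_neighbourhood_contains_cut)
  \<comment> \<open>The cut \<open>h\<close> obtained from the topology may stick out of
    \<open>e\<close>. Intersecting with \<open>e\<close> keeps \<omega> inside, and then a shortest
    walk from \<open>x\<close> in \<open>e\<close> to \<psi>(\<phi> x) outside \<open>e\<close>
    meets the boundary of \<open>e\<close> within distance \<open>c\<close> of
    \<open>x\<close>.\<close>
  have "gdiam X (h \<inter> e) < \<infinity>"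
  proof (rule X.gdiam_neighbourhood[where r = "nat \<lceil>c\<rceil>"])
    show "gdiam X (vboundary X e) < \<infinity>" using e unfolding metric_cut_def by blast
    show "vboundary X e \<subseteq> verts X" by (auto simp: vboundary_def)
    show "h \<inter> e \<subseteq> verts X" using eV by blast
    fix x assume x: "x \<in> h \<inter> e"
    then have xV: "x \<in> verts X" using eV by blast
    have V: "\<phi> x \<in> verts Y" "\<psi> (\<phi> x) \<in> verts X" using qi xV unfolding quasi_isometry_def by auto
    have "Inl x \<in> U" using x h(3) unfolding with_ends_def by blast
    then have "Inl (\<phi> x) \<in> with_ends Y (verts Y - ?f)"
      using ext xV unfolding U_def end_extension_def by auto
    then have "\<psi> (\<phi> x) \<notin> e" unfolding with_ends_def by auto
    then obtain w where w: "w \<in> vboundary X e" "gdist X x w \<le> gdist X x (\<psi> (\<phi> x))"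
      using X.near_vboundary[of x e "\<psi> (\<phi> x)"] x xV V by blast
    have "real (gdist X (\<psi> (\<phi> x)) x) \<le> c" using qi xV unfolding quasi_isometry_def by blast
    then have "gdist X x (\<psi> (\<phi> x)) \<le> nat \<lceil>c\<rceil>" using X.gdist_sym[OF xV V(2)] by linarith
    then show "\<exists>w\<in>vboundary X e. gdist X x w \<le> nat \<lceil>c\<rceil>" using w by (meson order_trans)
  qed
  then have "ends_in X (h \<inter> e) = {}" by (rule ends_in_bounded)
  then show False using \<omega> h(2) unfolding ends_in_Int by blast
qed

theorem theorem7:
  fixes X :: "'a ugraph" and Y :: "'b ugraph"
    and \<phi> :: "'a \<Rightarrow> 'b" and \<psi> :: "'b \<Rightarrow> 'a"
    and a b c :: real and d :: nat
    and \<Phi> :: "'a vertex_or_end \<Rightarrow> 'b vertex_or_end"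
    and e :: "'a set"
  assumes "simple_graph X" and "connected_graph X"
    and "simple_graph Y" and "connected_graph Y"
    and "quasi_isometry X Y \<phi> \<psi> a b c (real d)"
    and "end_extension X Y \<phi> \<Phi>"
    and "e \<subseteq> verts X" and "gdiam X (vboundary X e) < \<infinity>"
  shows "openin (end_topology Y) (thicken Y (\<Phi> ` with_ends X e) (d + 1))"
proof -
  interpret X: simple_connected_graph X using assms by unfold_locales
  interpret Y: simple_connected_graph Y using assms by unfold_locales
  note qi = assms(5) and ext = assms(6)
  let ?T = "thicken Y (\<Phi> ` with_ends X e) (d + 1)"
  let ?f = "{y \<in> verts Y. \<psi> y \<in> e}"
  have e: "metric_cut X e" using assms unfolding metric_cut_def by blast
  have f: "metric_cut Y ?f"
    using X.simple_connected_graph_axioms Y.simple_connected_graph_axioms qi e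
    by (rule metric_cut_quasi_preimage)
  \<comment> \<open>The vertex \<phi>(\<psi> y) belongs to the image of \<open>e\<close> and is
    within distance \<open>d\<close> of \<open>y\<close>.\<close>
  have f_sub: "Inl y \<in> ?T" if y: "y \<in> ?f" for y
  proof -
    have V: "y \<in> verts Y" "\<psi> y \<in> verts X" "\<phi> (\<psi> y) \<in> verts Y"
      using y qi unfolding quasi_isometry_def by auto
    have "real (gdist Y (\<phi> (\<psi> y)) y) \<le> real d" using qi V unfolding quasi_isometry_def by blast
    then have "gdist Y y (\<phi> (\<psi> y)) \<le> d" using Y.gdist_sym[OF V(1,3)] by simp
    moreover have "\<phi> (\<psi> y) \<in> Inl -` (\<Phi> ` with_ends X e)"
    proof -
      have "\<Phi> (Inl (\<psi> y)) = Inl (\<phi> (\<psi> y))" using ext V(2) unfolding end_extension_def by blast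
      moreover have "Inl (\<psi> y) \<in> with_ends X e" using y unfolding with_ends_def by blast
      ultimately show ?thesis by (metis imageI vimageI)
    qed
    ultimately have "gsetdist Y y (Inl -` (\<Phi> ` with_ends X e)) \<le> enat (d + 1)"
      unfolding gsetdist_def by (intro INF_lower2) auto
    then show ?thesis using V(1) unfolding thicken_def by blast
  qed
  have ends_sub: "Inr ` ends_in X e \<subseteq> end_points X"
    using ends_in_mono[OF assms(7)] unfolding end_points_def by blast
  \<comment> \<open>\<Phi> is known to be an open map only between the spaces of ends, so the open
    set is first reduced to its trace there.\<close>
  have "with_ends X e \<inter> end_points X = Inr ` ends_in X e"
    using ends_sub unfolding with_ends_def end_points_def by auto
  then have "openin (subtopology (end_topology X) (end_points X)) (Inr ` ends_in X e)"
    using openin_with_ends[OF e] unfolding openin_subtopology by metis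
  then have "openin (subtopology (end_topology Y) (end_points Y)) (\<Phi> ` Inr ` ends_in X e)"
    using ext homeomorphic_imp_open_map unfolding end_extension_def open_map_def by blast
  \<comment> \<open>Only the ends of \<open>U\<close> are controlled; its vertices may lie far from
    \<phi>(e).\<close>
  then obtain U where U: "openin (end_topology Y) U" "\<Phi> ` Inr ` ends_in X e = U \<inter> end_points Y"
    unfolding openin_subtopology by blast
  have "\<exists>W. openin (end_topology Y) W \<and> p \<in> W \<and> W \<subseteq> ?T" if p: "p \<in> ?T" for p
  proof (cases p)
    case (Inl y)
    then have "y \<in> verts Y" using p unfolding thicken_def by blast
    then show ?thesis using Inl p Y.openin_vertex by blast
  next
    case (Inr \<eta>)
    then have "Inr \<eta> \<in> \<Phi> ` with_ends X e" using p unfolding thicken_def by blast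
    \<comment> \<open>Vertices of \<open>e\<close> are mapped to vertices, so a preimage of
      \<open>Inr \<eta>\<close> in \<open>with_ends X e\<close> must be an end.\<close>
    then obtain \<omega> where \<omega>: "\<omega> \<in> ends_in X e" "\<Phi> (Inr \<omega>) = Inr \<eta>"
      using ext assms(7) unfolding with_ends_def end_extension_def by fastforce
    have "\<eta> \<in> ends_in Y ?f"
      using X.simple_connected_graph_axioms Y.simple_connected_graph_axioms qi ext e \<omega>
      by (rule end_extension_image_in_quasi_preimage)
    then have "p \<in> with_ends Y ?f" using Inr unfolding with_ends_def by blast
    moreover have "p \<in> U" using U(2) \<omega> Inr by (metis IntE imageI)
    \<comment> \<open>The two factors share the work: \<open>?f\<close> keeps the vertices inside
      the thickened set, and \<open>U\<close> keeps the ends inside the image.\<close>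
    moreover have "q \<in> ?T" if q: "q \<in> U \<inter> with_ends Y ?f" for q
    proof (cases q)
      case (Inl y)
      then show ?thesis using q f_sub unfolding with_ends_def by blast
    next
      case (Inr \<zeta>)
      then have "q \<in> end_points Y"
        using q ends_in_mono[of ?f "verts Y" Y] unfolding with_ends_def end_points_def by blast
      then have "q \<in> \<Phi> ` Inr ` ends_in X e" using q unfolding U(2) by blast
      then have "q \<in> \<Phi> ` with_ends X e" unfolding with_ends_def image_Un by (rule UnI2)
      then have "\<zeta> \<in> Inr -` (\<Phi> ` with_ends X e)" unfolding Inr by (rule vimageI2)
      then show ?thesis unfolding thicken_def Inr by (intro UnI2 imageI)
    qed
    ultimately show ?thesis using U(1) openin_with_ends[OF f]
      by (intro exI[of _ "U \<inter> with_ends Y ?f"]) auto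
  qed
  then show ?thesis using openin_subopen by blast
qed

end
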